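(* Let $V$ be any vertex algebra. The degree zero subspace $\mathrm{gr}_{\mathcal{E}}(V)_{(0)}=E_0(V)/E_1(V)$ of the $\mathbb{N}$-graded vertex Poisson algebra $\mathrm{gr}_{\mathcal{E}}(V)=\coprod_{n\ge 0}E_n(V)/E_{n+1}(V)$ is naturally a Poisson algebra, with product and bracket $$(u+E_1)(v+E_1)=u_{-1}v+E_1,\qquad [u+E_1,v+E_1]=u_0v+E_1\qquad(u,v\in V),$$ and it coincides with Zhu's Poisson algebra $V/C_2(V)$; that is, $E_0(V)=V$, $E_1(V)=C_2(V)$ and the two Poisson algebra structures are the same.
   Context: Vector spaces are over $\mathbb{C}$. For a vertex algebra $V$ write $Y(u,x)=\sum_{n\in\mathbb{Z}}u_nx^{-n-1}$. For $n\in\mathbb{Z}$, $E_n=E_n(V)$ is the linear span of the vectors $u^{(1)}_{-1-k_1}\cdots u^{(r)}_{-1-k_r}v$ for $r\ge 1$, $u^{(1)},\dots,u^{(r)},v\in V$, $k_1,\dots,k_r\ge 0$ with $k_1+\cdots+k_r\ge n$. The structure on $\mathrm{gr}_{\mathcal{E}}(V)$ is: for $a\in E_r$, $b\in E_s$, the product is $(a+E_{r+1})(b+E_{s+1})=a_{-1}b+E_{r+s+1}$, and for $n\ge 0$ the $n$-th vertex Lie product is $(a+E_{r+1})_n(b+E_{s+1})=a_nb+E_{r+s-n+1}$. The natural bracket on the degree zero subspace is the $n=0$ product. $C_2(V)$ is the linear span of the vectors $u_{-2}v$, $u,v\in V$. Zhu's Poisson algebra is $V/C_2(V)$ with $\bar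 u\cdot\bar v=\overline{u_{-1}v}$, $[\bar u,\bar v]=\overline{u_0v}$, where $\bar u=u+C_2(V)$, and with identity $\mathbf{1}+C_2(V)$. *)

theory Defs
  imports
    Complex_Main
    "HOL-Algebra.Module"
    "HOL-Library.Groups_Big_Fun"
    "HOL-Library.Set_Algebras"
begin

text \<open>
  \<open>mode u n v\<close> is $u_n v$, where $Y(u,x) = \sum_n u_n x^{-n-1}$. The axiom \<open>jacobi\<close> is the Jacobi
  identity
  $$x_0^{-1}\delta\Big(\frac{x_1-x_2}{x_0}\Big) Y(u,x_1)Y(v,x_2)
    - x_0^{-1}\delta\Big(\frac{x_2-x_1}{-x_0}\Big) Y(v,x_2)Y(u,x_1)
    = x_2^{-1}\delta\Big(\frac{x_1-x_0}{x_2}\Big) Y(Y(u,x_0)v,x_2)$$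
  applied to \<open>w\<close>, at the coefficient of $x_0^{-l-1} x_1^{-m-1} x_2^{-n-1}$. By \<open>truncation\<close> only
  finitely many summands are nonzero, so \<open>Sum_any\<close> is the intended sum.
\<close>

locale vertex_algebra = vector_space scale
  for scale :: "complex \<Rightarrow> 'v::ab_group_add \<Rightarrow> 'v"  (infixr \<open>*s\<close> 75) +
  fixes vac :: 'v
    and mode :: "'v \<Rightarrow> int \<Rightarrow> 'v \<Rightarrow> 'v"
  assumes linear_left: "Vector_Spaces.linear scale scale (\<lambda>u. mode u n v)"
    and linear_right: "Vector_Spaces.linear scale scale (\<lambda>v. mode u n v)"
    and truncation: "\<exists>N. \<forall>n\<ge>N. mode u n v = 0"
    and vacuum: "mode vac n v = (if n = -1 then v else 0)"
    and creation: "mode v (-1) vac = v" "n \<ge> 0 \<Longrightarrow> mode v n vac = 0"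
    and jacobi:
      "Sum_any (\<lambda>i::nat. (of_int m gchoose i) *s mode (mode u (l + int i) v) (m + n - int i) w) =
       Sum_any (\<lambda>i::nat. ((-1) ^ i * (of_int l gchoose i)) *s
         (mode u (m + l - int i) (mode v (n + int i) w)
          - ((-1) powi l) *s mode v (n + l - int i) (mode u (m + int i) w)))"

definition complex_ring :: "complex ring" where
  "complex_ring = \<lparr>carrier = UNIV, monoid.mult = (*), one = 1, zero = 0, add = (+)\<rparr>"

record 'a poisson = "(complex, 'a) module" +
  bracket :: "'a \<Rightarrow> 'a \<Rightarrow> 'a"

text \<open>Since \<open>algebra\<close> includes \<open>cring\<close>, the associative product is commutative and unital.\<close>

locale poisson_algebra = algebra complex_ring P for P :: "('a, 'b) poisson_scheme" (structure) +
  assumes bracket_closed: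
      "\<lbrakk>x \<in> carrier P; y \<in> carrier P\<rbrakk> \<Longrightarrow> bracket P x y \<in> carrier P"
    and bracket_add_left:
      "\<lbrakk>x \<in> carrier P; y \<in> carrier P; z \<in> carrier P\<rbrakk> \<Longrightarrow>
        bracket P (x \<oplus>\<^bsub>P\<^esub> y) z = bracket P x z \<oplus>\<^bsub>P\<^esub> bracket P y z"
    and bracket_add_right:
      "\<lbrakk>x \<in> carrier P; y \<in> carrier P; z \<in> carrier P\<rbrakk> \<Longrightarrow>
        bracket P x (y \<oplus>\<^bsub>P\<^esub> z) = bracket P x y \<oplus>\<^bsub>P\<^esub> bracket P x z"
    and bracket_smult_left:
      "\<lbrakk>x \<in> carrier P; y \<in> carrier P\<rbrakk> \<Longrightarrow>
        bracket P (c \<odot>\<^bsub>P\<^esub> x) y = c \<odot>\<^bsub>P\<^esub> bracket P x y"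
    and bracket_smult_right:
      "\<lbrakk>x \<in> carrier P; y \<in> carrier P\<rbrakk> \<Longrightarrow>
        bracket P x (c \<odot>\<^bsub>P\<^esub> y) = c \<odot>\<^bsub>P\<^esub> bracket P x y"
    and bracket_self:
      "x \<in> carrier P \<Longrightarrow> bracket P x x = \<zero>\<^bsub>P\<^esub>"
    and bracket_jacobi:
      "\<lbrakk>x \<in> carrier P; y \<in> carrier P; z \<in> carrier P\<rbrakk> \<Longrightarrow>
        bracket P x (bracket P y z) \<oplus>\<^bsub>P\<^esub> bracket P y (bracket P z x)
          \<oplus>\<^bsub>P\<^esub> bracket P z (bracket P x y) = \<zero>\<^bsub>P\<^esub>"
    and bracket_leibniz:
      "\<lbrakk>x \<in> carrier P; y \<in> carrier P; z \<in> carrier P\<rbrakk> \<Longrightarrow>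
        bracket P x (y \<otimes>\<^bsub>P\<^esub> z) = bracket P x y \<otimes>\<^bsub>P\<^esub> z \<oplus>\<^bsub>P\<^esub> y \<otimes>\<^bsub>P\<^esub> bracket P x z"

text \<open>
  Cosets are sets \<open>u +o W\<close>. The induced operations take the union over all representatives
  (as \<open>rcoset_mult\<close> does for quotient rings); the union is a single coset of \<open>W\<close> exactly when
  the operation is well defined.
\<close>

definition cosets :: "'v::ab_group_add set \<Rightarrow> 'v set \<Rightarrow> 'v set set" where
  "cosets U W = (\<lambda>u. u +o W) ` U"

definition induced1 :: "'v::ab_group_add set \<Rightarrow> ('v \<Rightarrow> 'v) \<Rightarrow> 'v set \<Rightarrow> 'v set" where
  "induced1 W f A = (\<Union>a\<in>A. f a +o W)"

definition induced2 :: "'v::ab_group_add set \<Rightarrow> ('v \<Rightarrow> 'v \<Rightarrow> 'v) \<Rightarrow> 'v set \<Rightarrow> 'v set \<Rightarrow> 'v set" where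
  "induced2 W f A B = (\<Union>a\<in>A. \<Union>b\<in>B. f a b +o W)"

context vertex_algebra
begin

text \<open>
  The list \<open>[(u\<^sub>1, k\<^sub>1), \<dots>, (u\<^sub>r, k\<^sub>r)]\<close> together with \<open>v\<close> encodes the vector
  $u^{(1)}_{-1-k_1} \cdots u^{(r)}_{-1-k_r} v$.
\<close>

definition E :: "int \<Rightarrow> 'v set" where
  "E n = span {foldr (\<lambda>(u, k). mode u (-1 - int k)) ps v | ps v.
     ps \<noteq> [] \<and> int (sum_list (map snd ps)) \<ge> n}"

definition C2 :: "'v set" where
  "C2 = span {mode u (-2) v | u v. True}"

text \<open>
  The graded space is given by its homogeneous components $E_r/E_{r+1}$, with the product
  and the \<open>n\<close>-th vertex Lie products of components of degrees \<open>r\<close> and \<open>s\<close>.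
\<close>

definition gr :: "nat \<Rightarrow> 'v set set" where
  "gr r = cosets (E (int r)) (E (int r + 1))"

definition gr_mult :: "nat \<Rightarrow> nat \<Rightarrow> 'v set \<Rightarrow> 'v set \<Rightarrow> 'v set" where
  "gr_mult r s = induced2 (E (int r + int s + 1)) (\<lambda>a b. mode a (-1) b)"

definition gr_lie :: "nat \<Rightarrow> nat \<Rightarrow> nat \<Rightarrow> 'v set \<Rightarrow> 'v set \<Rightarrow> 'v set" where
  "gr_lie n r s = induced2 (E (int r + int s - int n + 1)) (\<lambda>a b. mode a (int n) b)"

definition gr_degree_zero :: "'v set poisson" where
  "gr_degree_zero =
    \<lparr>carrier = gr 0,
     monoid.mult = gr_mult 0 0,
     one = vac +o E 1,
     zero = E 1,
     add = induced2 (E 1) (+),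
     smult = (\<lambda>c. induced1 (E 1) (scale c)),
     bracket = gr_lie 0 0 0\<rparr>"

definition zhu_poisson :: "'v set poisson" where
  "zhu_poisson =
    \<lparr>carrier = cosets UNIV C2,
     monoid.mult = induced2 C2 (\<lambda>u v. mode u (-1) v),
     one = vac +o C2,
     zero = C2,
     add = induced2 C2 (+),
     smult = (\<lambda>c. induced1 C2 (scale c)),
     bracket = induced2 C2 (\<lambda>u v. mode u 0 v)\<rparr>"

end

end

theory Submission
  imports Defs
begin

text \<open>
  Everything follows from the two special cases \<open>m = 0\<close> (iterate formula) and \<open>l = 0\<close>
  (commutator formula) of the Jacobi identity. The iterate formula for $(u_{-1-k} \mathbf{1})_{-2} w$
  has the single nonzero summand $(k+1)\, u_{-2-k} w$, so all $u_{-2-k} w$ lie in $C_2$. Hence $C_2$ is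
  an ideal for both products, which gives $E_1 = C_2$, and the terms by which commutativity,
  associativity and skew symmetry fail are modes of index at most $-2$.
\<close>

section \<open>Quotients by a subspace\<close>

context vector_space
begin

lemma elt_set_plus_eq_iff:
  assumes "subspace W"
  shows "u +o W = v +o W \<longleftrightarrow> u - v \<in> W"
proof
  assume "u +o W = v +o W"
  moreover have "u \<in> u +o W"
    using subspace_0[OF assms] by (force simp: elt_set_plus_def)
  ultimately show "u - v \<in> W"
    by (auto simp: elt_set_plus_def)
next
  assume uv: "u - v \<in> W"
  have "\<exists>b\<in>W. u + a = v + b" if "a \<in> W" for a
    using subspace_add[OF assms uv that] by (intro bexI[of _ "u - v + a"]) auto
  moreover have "\<exists>b\<in>W. v + a = u + b" if "a \<in> W" for a
    using subspace_diff[OF assms that uv] by (intro bexI[of _ "a - (u - v)"]) auto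
  ultimately show "u +o W = v +o W"
    by (auto simp: elt_set_plus_def)
qed

lemma elt_set_plus_mem_iff:
  assumes "subspace W"
  shows "a \<in> u +o W \<longleftrightarrow> a - u \<in> W"
  by (auto simp: elt_set_plus_def intro: bexI[of _ "a - u"])

lemma induced1_coset:
  assumes W: "subspace W"
    and cong: "\<And>a a'. a - a' \<in> W \<Longrightarrow> f a - f a' \<in> W"
  shows "induced1 W f (u +o W) = f u +o W"
proof -
  have "f a +o W = f u +o W" if "a \<in> u +o W" for a
    using that cong by (simp add: elt_set_plus_eq_iff[OF W] elt_set_plus_mem_iff[OF W])
  moreover have "u \<in> u +o W"
    by (simp add: elt_set_plus_mem_iff[OF W] subspace_0[OF W])
  ultimately show ?thesis
    unfolding induced1_def by blast
qed

text \<open>By \<open>cong\<close> all cosets in the union coincide, and the union is nonempty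
  because \<open>u\<close> and \<open>v\<close> represent their own cosets. This turns congruence
  modulo \<open>W\<close> into well-definedness on the quotient.\<close>

lemma induced2_coset:
  assumes W: "subspace W"
    and cong: "\<And>a a' b b'. \<lbrakk>a - a' \<in> W; b - b' \<in> W\<rbrakk> \<Longrightarrow> f a b - f a' b' \<in> W"
  shows "induced2 W f (u +o W) (v +o W) = f u v +o W"
proof -
  have "f a b +o W = f u v +o W" if "a \<in> u +o W" "b \<in> v +o W" for a b
    using that cong by (simp add: elt_set_plus_eq_iff[OF W] elt_set_plus_mem_iff[OF W])
  moreover have "u \<in> u +o W" "v \<in> v +o W"
    by (simp_all add: elt_set_plus_mem_iff[OF W] subspace_0[OF W])
  ultimately show ?thesis
    unfolding induced2_def by blast
qed

end

section \<open>Complex scalars and sums with one nonzero term\<close>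

lemma cring_complex_ring: "cring complex_ring"
proof (intro cringI abelian_groupI comm_monoidI)
  fix x :: complex
  show "\<exists>y\<in>carrier complex_ring. y \<oplus>\<^bsub>complex_ring\<^esub> x = \<zero>\<^bsub>complex_ring\<^esub>"
    by (intro bexI[of _ "- x"]) (auto simp: complex_ring_def)
qed (auto simp: complex_ring_def algebra_simps)

lemma zero_gbinomial: "i > 0 \<Longrightarrow> ((0 :: complex) gchoose i) = 0"
  by (cases i) auto

lemma Sum_any_eq_single:
  fixes f :: "'a \<Rightarrow> 'b::comm_monoid_add"
  assumes "\<And>i. i \<noteq> j \<Longrightarrow> f i = 0"
  shows "Sum_any f = f j"
proof -
  have "Sum_any f = sum f {j}"
    using assms by (intro Sum_any.expand_superset) auto
  then show ?thesis
    by simp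
qed

section \<open>Special cases of the Jacobi identity\<close>

context vertex_algebra
begin

lemma mode_add_left: "mode (a + b) n v = mode a n v + mode b n v"
  using linear_left by (simp add: Vector_Spaces.linear_iff)

lemma mode_scale_left: "mode (c *s a) n v = c *s mode a n v"
  using linear_left by (simp add: Vector_Spaces.linear_iff)

lemma mode_add_right: "mode u n (a + b) = mode u n a + mode u n b"
  using linear_right by (simp add: Vector_Spaces.linear_iff)

lemma mode_scale_right: "mode u n (c *s a) = c *s mode u n a"
  using linear_right by (simp add: Vector_Spaces.linear_iff)

lemma mode_zero_left [simp]: "mode 0 n v = 0"
  using mode_scale_left[of 0 0 n v] by simp

lemma mode_zero_right [simp]: "mode u n 0 = 0"
  using mode_scale_right[of u n 0 0] by simp

lemma mode_diff_left: "mode (a - b) n v = mode a n v - mode b n v"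
  using mode_add_left[of "a - b" b n v] by (simp add: eq_diff_eq)

lemma mode_diff_right: "mode u n (a - b) = mode u n a - mode u n b"
  using mode_add_right[of u n "a - b" b] by (simp add: eq_diff_eq)

lemma eventually_mode_eq_zero: "\<exists>N. \<forall>i\<ge>N. mode u (k + int i) v = 0"
proof -
  obtain N where N: "\<forall>n\<ge>N. mode u n v = 0"
    using truncation by blast
  then have "\<forall>i\<ge>nat (N - k). mode u (k + int i) v = 0"
    by auto
  then show ?thesis ..
qed

lemma iterate_formula:
  "mode (mode u l v) n w =
   Sum_any (\<lambda>i. ((-1) ^ i * (of_int l gchoose i)) *s
     (mode u (l - int i) (mode v (n + int i) w)
      - ((-1) powi l) *s mode v (n + l - int i) (mode u (int i) w)))"
proof -
  have "Sum_any (\<lambda>i::nat. (of_int 0 gchoose i) *s mode (mode u (l + int i) v) (0 + n - int i) w)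
    = mode (mode u l v) n w"
    by (subst Sum_any_eq_single[of 0]) (auto simp: zero_gbinomial)
  then show ?thesis
    using jacobi[of 0 u l v n w] by simp
qed

lemma commutator_formula:
  "mode u m (mode v n w) - mode v n (mode u m w) =
   Sum_any (\<lambda>i. (of_int m gchoose i) *s mode (mode u (int i) v) (m + n - int i) w)"
proof -
  have "Sum_any (\<lambda>i::nat. ((-1) ^ i * (of_int 0 gchoose i)) *s
         (mode u (m + 0 - int i) (mode v (n + int i) w)
          - ((-1) powi 0) *s mode v (n + 0 - int i) (mode u (m + int i) w)))
    = mode u m (mode v n w) - mode v n (mode u m w)"
    by (subst Sum_any_eq_single[of 0]) (auto simp: zero_gbinomial)
  then show ?thesis
    using jacobi[of m u 0 v n w] by simp
qed

text \<open>At \<open>m = 0\<close> the binomials kill every summand with \<open>i > 0\<close>, so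
  \<open>mode u 0\<close> is a derivation of every product. This is an exact identity, the source of
  both the Leibniz rule and the Jacobi identity of the bracket.\<close>

lemma commutator_zero_mode:
  "mode u 0 (mode v n w) - mode v n (mode u 0 w) = mode (mode u 0 v) n w"
  unfolding commutator_formula
  by (subst Sum_any_eq_single[of 0]) (auto simp: zero_gbinomial)

section \<open>Congruences modulo \<open>C2\<close>\<close>

lemma subspace_C2: "subspace C2"
  by (simp add: C2_def)

lemmas C2_add = subspace_add[OF subspace_C2]
  and C2_diff = subspace_diff[OF subspace_C2]
  and C2_neg = subspace_neg[OF subspace_C2]
  and C2_scale = subspace_scale[OF subspace_C2]

lemma C2_induct [consumes 1, case_names zero add scale mode]:
  assumes "x \<in> C2"
    and "P 0"
    and "\<And>x y. \<lbrakk>P x; P y\<rbrakk> \<Longrightarrow> P (x + y)"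
    and "\<And>c x. P x \<Longrightarrow> P (c *s x)"
    and "\<And>a b. P (mode a (-2) b)"
  shows "P x"
  using assms(1) unfolding C2_def
  by (rule span_induct_alt) (use assms(2-) in auto)

lemma mode_in_C2:
  assumes "n \<le> -2"
  shows "mode u n w \<in> C2"
proof -
  define k where "k = nat (- 2 - n)"
  \<comment> \<open>With \<open>l = n + 1\<close> the summand at \<open>i = 1\<close> contains
    \<open>mode u n w\<close>. It is the only survivor: \<open>mode vac (-2 + i)\<close> is nonzero
    only at \<open>i = 1\<close>, and the index \<open>-2 + l - i\<close> never equals
    \<open>-1\<close> because \<open>l\<close> is negative.\<close>
  define l where "l = -1 - int k"
  have n: "n = l - 1"
    using assms by (simp add: k_def l_def)
  have "mode (mode u l vac) (-2) w = - (of_int l) *s mode u n w"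
    unfolding iterate_formula
    by (subst Sum_any_eq_single[of 1]) (auto simp: vacuum n l_def)
  moreover have "mode (mode u l vac) (-2) w \<in> C2"
    unfolding C2_def by (intro span_base) blast
  ultimately have "of_int l *s mode u n w \<in> C2"
    using C2_neg[of "mode (mode u l vac) (-2) w"] by simp
  then have "(1 / of_int l) *s of_int l *s mode u n w \<in> C2"
    by (rule C2_scale)
  moreover have "(of_int l :: complex) \<noteq> 0"
    by (simp add: l_def del: of_int_diff)
  ultimately show ?thesis
    by simp
qed

text \<open>No finiteness is required: a sum of infinite support has the default value 0, which also
  lies in \<open>C2\<close>.\<close>

lemma Sum_any_in_C2:
  assumes "\<And>i. f i \<in> C2"
  shows "Sum_any f \<in> C2"
  unfolding Sum_any.expand_set by (intro subspace_sum subspace_C2 assms)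

text \<open>Splitting off the first summand does need finite support, supplied by the bound
  \<open>N\<close>; truncation provides it in the applications.\<close>

lemma Sum_any_minus_first_in_C2:
  fixes f :: "nat \<Rightarrow> 'v"
  assumes "\<And>i. i \<ge> N \<Longrightarrow> f i = 0" and "\<And>i. i > 0 \<Longrightarrow> f i \<in> C2"
  shows "Sum_any f - f 0 \<in> C2"
proof -
  have "Sum_any f = sum f {..N}"
    using assms(1) by (intro Sum_any.expand_superset) (auto intro: ccontr)
  also have "\<dots> = f 0 + sum f {0<..N}"
    using sum.head[of 0 N f] by (simp add: atLeast0AtMost)
  also have "\<dots> - f 0 = sum f {0<..N}"
    by simp
  also have "\<dots> \<in> C2"
    by (intro subspace_sum subspace_C2) (auto intro: assms)
  finally show ?thesis .
qed

text \<open>Moving \<open>mode u n\<close> past \<open>mode a (-2)\<close> costs modes of index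
  \<open>n - 2 - i\<close>, at most \<open>-2\<close> for these \<open>n\<close>; what remains
  begins with \<open>mode a (-2)\<close>.\<close>

lemma mode_right_in_C2:
  assumes "x \<in> C2" and "n = -1 \<or> n = 0"
  shows "mode u n x \<in> C2"
  using assms(1)
proof (induction rule: C2_induct)
  case (mode a b)
  have "mode u n (mode a (-2) b) - mode a (-2) (mode u n b) \<in> C2"
    unfolding commutator_formula
    using assms(2) by (intro Sum_any_in_C2 C2_scale mode_in_C2) auto
  from C2_add[OF this mode_in_C2[of "-2" a "mode u n b"]] show ?case
    by simp
qed (auto simp: mode_add_right mode_scale_right C2_add C2_scale subspace_0[OF subspace_C2])

text \<open>Every term of the iterate formula for \<open>mode (mode a (-2) b) n w\<close> has
  outermost index \<open>-2 - i\<close> or \<open>n - 2 - i\<close>, hence at most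
  \<open>-2\<close>.\<close>

lemma mode_left_in_C2:
  assumes "x \<in> C2" and "n = -1 \<or> n = 0"
  shows "mode x n w \<in> C2"
  using assms(1)
proof (induction rule: C2_induct)
  case (mode a b)
  show ?case
    unfolding iterate_formula
    using assms(2) by (intro Sum_any_in_C2 C2_scale C2_diff mode_in_C2) auto
qed (auto simp: mode_add_left mode_scale_left C2_add C2_scale subspace_0[OF subspace_C2])

lemma mode_cong_C2:
  assumes "a - a' \<in> C2" and "b - b' \<in> C2" and "n = -1 \<or> n = 0"
  shows "mode a n b - mode a' n b' \<in> C2"
proof -
  have "mode a n b - mode a' n b' = mode (a - a') n b + mode a' n (b - b')"
    by (simp add: mode_diff_left mode_diff_right)
  then show ?thesis
    using assms by (simp add: C2_add mode_left_in_C2 mode_right_in_C2)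
qed

text \<open>The commutator of \<open>mode u (-1)\<close> and \<open>mode v (-1)\<close> on the
  vacuum involves only modes of index \<open>-2 - i\<close>; creation recovers \<open>u\<close> and
  \<open>v\<close>.\<close>

lemma mult_commute_C2: "mode u (-1) v - mode v (-1) u \<in> C2"
proof -
  have "mode u (-1) (mode v (-1) vac) - mode v (-1) (mode u (-1) vac) \<in> C2"
    unfolding commutator_formula by (intro Sum_any_in_C2 C2_scale mode_in_C2) simp
  then show ?thesis
    by (simp add: creation)
qed

lemma mult_assoc_C2: "mode (mode u (-1) v) (-1) w - mode u (-1) (mode v (-1) w) \<in> C2"
proof -
  define f where "f = (\<lambda>i. ((-1) ^ i * (of_int (-1) gchoose i)) *s
     (mode u (-1 - int i) (mode v (-1 + int i) w)
      - ((-1) powi (-1)) *s mode v (-1 + -1 - int i) (mode u (int i) w)))"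
  obtain N M where N: "\<forall>i\<ge>N. mode v (-1 + int i) w = 0" and M: "\<forall>i\<ge>M. mode u (0 + int i) w = 0"
    using eventually_mode_eq_zero by meson
  have "Sum_any f - f 0 \<in> C2"
  proof (rule Sum_any_minus_first_in_C2[of "max N M"])
    show "f i = 0" if "i \<ge> max N M" for i
      using that N M by (simp add: f_def)
    show "f i \<in> C2" if "i > 0" for i
      unfolding f_def using that by (intro C2_scale C2_diff mode_in_C2) auto
  qed
  then have "mode (mode u (-1) v) (-1) w - f 0 \<in> C2"
    unfolding iterate_formula f_def .
  \<comment> \<open>The difference is the second half of the summand at \<open>i = 0\<close>, namely
    \<open>mode v (-2) (mode u 0 w)\<close>.\<close>
  moreover have "f 0 - mode u (-1) (mode v (-1) w) \<in> C2"
    by (simp add: f_def mode_in_C2)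
  ultimately show ?thesis
    using C2_add by fastforce
qed

text \<open>The commutator of \<open>mode u (-1)\<close> and \<open>mode v 0\<close> on the vacuum
  is \<open>- mode v 0 u\<close> by creation. In its expansion the term \<open>i = 0\<close> is
  \<open>mode u 0 v\<close>, and later terms have index at most \<open>-2\<close>.\<close>

lemma bracket_skew_C2: "mode u 0 v + mode v 0 u \<in> C2"
proof -
  define f where "f = (\<lambda>i. (of_int (-1) gchoose i) *s mode (mode u (int i) v) (-1 + 0 - int i) vac)"
  obtain N where N: "\<forall>i\<ge>N. mode u (0 + int i) v = 0"
    using eventually_mode_eq_zero by meson
  have "Sum_any f - f 0 \<in> C2"
  proof (rule Sum_any_minus_first_in_C2[of N])
    show "f i = 0" if "i \<ge> N" for i
      using that N by (simp add: f_def)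
    show "f i \<in> C2" if "i > 0" for i
      unfolding f_def using that by (intro C2_scale mode_in_C2) auto
  qed
  moreover have "Sum_any f = - mode v 0 u"
    using commutator_formula[of u "-1" v 0 vac] by (simp add: f_def creation)
  moreover have "f 0 = mode u 0 v"
    by (simp add: f_def creation)
  ultimately have "- mode v 0 u - mode u 0 v \<in> C2"
    by simp
  from C2_neg[OF this] show ?thesis
    by simp
qed

lemma bracket_self_C2: "mode u 0 u \<in> C2"
proof -
  have "(1/2) *s (mode u 0 u + mode u 0 u) \<in> C2"
    by (intro C2_scale bracket_skew_C2)
  then show ?thesis
    by (simp add: scale_right_distrib flip: scale_left_distrib)
qed

lemma bracket_jacobi_C2:
  "mode u 0 (mode v 0 w) + mode v 0 (mode w 0 u) + mode w 0 (mode u 0 v) \<in> C2"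
proof -
  \<comment> \<open>The derivation property expands the first term; the four resulting terms pair up
    into two instances of skew symmetry.\<close>
  have "mode u 0 (mode v 0 w) + mode v 0 (mode w 0 u) + mode w 0 (mode u 0 v)
    = mode v 0 (mode u 0 w + mode w 0 u) + (mode (mode u 0 v) 0 w + mode w 0 (mode u 0 v))"
    using commutator_zero_mode[of u v 0 w] by (simp add: mode_add_right algebra_simps)
  also have "\<dots> \<in> C2"
    by (intro C2_add mode_right_in_C2 bracket_skew_C2) simp
  finally show ?thesis .
qed

section \<open>The filtration in degrees 0 and 1\<close>

lemma foldr_mode_in_E:
  assumes "ps \<noteq> []" and "int (sum_list (map snd ps)) \<ge> n"
  shows "foldr (\<lambda>(u, k). mode u (-1 - int k)) ps v \<in> E n"
  unfolding E_def by (rule span_base) (use assms in blast)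

lemma E_0: "E 0 = UNIV"
proof -
  have "v \<in> E 0" for v
    \<comment> \<open>Lists must be nonempty, so the identity operator \<open>mode vac (-1)\<close>
      serves as the single factor.\<close>
    using foldr_mode_in_E[of "[(vac, 0)]" 0 v] by (simp add: vacuum)
  then show ?thesis
    by auto
qed

text \<open>An outermost factor with positive \<open>k\<close> lands in \<open>C2\<close> by itself;
  one with \<open>k = 0\<close> preserves \<open>C2\<close>, and the remaining factors carry the
  whole sum.\<close>

lemma foldr_mode_in_C2:
  "sum_list (map snd ps) \<ge> 1 \<Longrightarrow> foldr (\<lambda>(u, k). mode u (-1 - int k)) ps v \<in> C2"
proof (induction ps)
  case (Cons p ps)
  obtain u k where p: "p = (u, k)"
    by fastforce
  show ?case
  proof (cases "k = 0")
    case True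
    then show ?thesis
      using Cons p by (simp add: mode_right_in_C2)
  next
    case False
    then show ?thesis
      using p by (simp add: mode_in_C2)
  qed
qed simp

lemma E_1: "E 1 = C2"
proof
  show "E 1 \<subseteq> C2"
    unfolding E_def by (intro span_minimal subspace_C2) (auto intro!: foldr_mode_in_C2)
  have "mode u (-2) v \<in> E 1" for u v
    using foldr_mode_in_E[of "[(u, 1)]" 1 v] by simp
  then show "C2 \<subseteq> E 1"
    unfolding C2_def by (intro span_minimal) (auto simp: E_def)
qed

section \<open>Zhu's Poisson algebra\<close>

lemmas C2_coset_eq_iff = elt_set_plus_eq_iff[OF subspace_C2]

lemma zhu_mult_coset:
  "(u +o C2) \<otimes>\<^bsub>zhu_poisson\<^esub> (v +o C2) = mode u (-1) v +o C2"
  by (simp add: zhu_poisson_def induced2_coset[OF subspace_C2] mode_cong_C2)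

lemma zhu_bracket_coset:
  "bracket zhu_poisson (u +o C2) (v +o C2) = mode u 0 v +o C2"
  by (simp add: zhu_poisson_def induced2_coset[OF subspace_C2] mode_cong_C2)

lemma zhu_add_coset: "(u +o C2) \<oplus>\<^bsub>zhu_poisson\<^esub> (v +o C2) = (u + v) +o C2"
proof -
  have "a + b - (a' + b') \<in> C2" if "a - a' \<in> C2" "b - b' \<in> C2" for a a' b b'
    using C2_add[OF that] by (simp add: algebra_simps)
  then show ?thesis
    by (simp add: zhu_poisson_def induced2_coset[OF subspace_C2])
qed

lemma zhu_smult_coset: "c \<odot>\<^bsub>zhu_poisson\<^esub> (u +o C2) = (c *s u) +o C2"
  by (simp add: zhu_poisson_def induced1_coset[OF subspace_C2] C2_scale flip: scale_right_diff_distrib)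

lemma zhu_one: "\<one>\<^bsub>zhu_poisson\<^esub> = vac +o C2"
  by (simp add: zhu_poisson_def)

text \<open>Zero is written as a coset so that the coset rules apply; \<open>set_zero_plus\<close>
  would undo this and is removed from the simplifier below.\<close>

lemma zhu_zero: "\<zero>\<^bsub>zhu_poisson\<^esub> = 0 +o C2"
  by (simp add: zhu_poisson_def)

lemma zhu_carrier: "carrier zhu_poisson = range (\<lambda>u. u +o C2)"
  by (simp add: zhu_poisson_def cosets_def)

lemmas zhu_simps = zhu_mult_coset zhu_bracket_coset zhu_add_coset zhu_smult_coset
  zhu_one zhu_zero zhu_carrier

lemma poisson_algebra_zhu: "poisson_algebra zhu_poisson"
proof -
  have "cring zhu_poisson"
  proof (intro cringI abelian_groupI comm_monoidI)
    fix x assume "x \<in> carrier zhu_poisson"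
    then obtain u where u: "x = u +o C2"
      by (auto simp: zhu_carrier)
    show "\<exists>y\<in>carrier zhu_poisson. y \<oplus>\<^bsub>zhu_poisson\<^esub> x = \<zero>\<^bsub>zhu_poisson\<^esub>"
      by (rule bexI[of _ "(- u) +o C2"]) (simp_all only: u zhu_simps, simp_all)
  qed (auto simp: zhu_simps C2_coset_eq_iff vacuum mode_add_left mult_commute_C2 mult_assoc_C2
      subspace_0[OF subspace_C2] add_ac simp del: set_zero_plus del: equalityI intro!: rangeI)
  then have "algebra complex_ring zhu_poisson"
    by (intro algebraI cring_complex_ring)
      (auto simp: zhu_simps complex_ring_def scale_left_distrib scale_right_distrib mode_scale_left
        simp del: set_zero_plus del: equalityI intro!: rangeI)
  then show ?thesis
  proof (rule poisson_algebra.intro)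
    \<comment> \<open>The Leibniz rule already holds in the vertex algebra, before passing to
      cosets.\<close>
    have "mode u 0 (mode v (-1) w) = mode (mode u 0 v) (-1) w + mode v (-1) (mode u 0 w)" for u v w
      using commutator_zero_mode[of u v "-1" w] by (simp add: algebra_simps)
    then show "poisson_algebra_axioms zhu_poisson"
      by unfold_locales
        (auto simp only: zhu_simps C2_coset_eq_iff mode_add_left mode_add_right mode_scale_left
          mode_scale_right bracket_self_C2 bracket_jacobi_C2 diff_zero diff_self subspace_0[OF subspace_C2]
          del: equalityI intro!: rangeI)
  qed
qed

text \<open>In degree 0 the product and the bracket both take values modulo \<open>E 1\<close>, so
  once \<open>E 0\<close> and \<open>E 1\<close> are identified the two records agree field by
  field.\<close>

lemma gr_degree_zero_eq_zhu_poisson: "gr_degree_zero = zhu_poisson"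
  by (simp only: gr_degree_zero_def zhu_poisson_def gr_def gr_mult_def gr_lie_def E_0 E_1
      of_nat_0 add_0 diff_zero)

end

theorem proposition3p8:
  fixes scale :: "complex \<Rightarrow> 'v::ab_group_add \<Rightarrow> 'v"
    and vac :: 'v
    and mode :: "'v \<Rightarrow> int \<Rightarrow> 'v \<Rightarrow> 'v"
  assumes "vertex_algebra scale vac mode"
  shows "let E = vertex_algebra.E scale mode;
             C2 = vertex_algebra.C2 scale mode;
             G = vertex_algebra.gr_degree_zero scale vac mode;
             Z = vertex_algebra.zhu_poisson scale vac mode
         in poisson_algebra G
          \<and> carrier G = cosets (E 0) (E 1)
          \<and> (\<forall>u v. (u +o E 1) \<otimes>\<^bsub>G\<^esub> (v +o E 1) = mode u (-1) v +o E 1)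
          \<and> (\<forall>u v. bracket G (u +o E 1) (v +o E 1) = mode u 0 v +o E 1)
          \<and> E 0 = UNIV
          \<and> E 1 = C2
          \<and> poisson_algebra Z
          \<and> (\<forall>u v. (u +o C2) \<otimes>\<^bsub>Z\<^esub> (v +o C2) = mode u (-1) v +o C2)
          \<and> (\<forall>u v. bracket Z (u +o C2) (v +o C2) = mode u 0 v +o C2)
          \<and> G = Z"
proof -
  interpret vertex_algebra scale vac mode
    by fact
  have "carrier zhu_poisson = cosets UNIV C2"
    by (simp add: zhu_poisson_def)
  then show ?thesis
    by (simp only: Let_def gr_degree_zero_eq_zhu_poisson E_0 E_1 zhu_mult_coset zhu_bracket_coset
        poisson_algebra_zhu simp_thms)
qed

end
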